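(* Let $u\in U$ be the solution of the continuous problem: $a(u,v)=l(v)$ for all $v\in V$. Let $u_\theta\in U_{NN}$ be a neural network function with trainable parameters $\theta\in\mathbb{R}^S$, let $V_M\subseteq V$ be a finite-dimensional subspace with norm $\|\cdot\|_V$, and let $\phi=\phi(\theta)\in V_M$ be the solution of $$(\phi,v_M)_V = l(v_M)-a(u_\theta,v_M)\quad\text{for all } v_M\in V_M .$$ Then $$\frac{1}{\mu}\,\|\phi\|_V \;\le\; \|u-u_\theta\|_U .$$
   Context: $U$ and $V$ are (real) Hilbert spaces with norms $\|\cdot\|_U$, $\|\cdot\|_V$; $(\cdot,\cdot)_V$ is the inner product of $V$, with $\|v\|_V^2=(v,v)_V$. $l\in V'$ is a bounded linear functional and $a:U\times V\to\mathbb{R}$ is a bilinear form for which there are constants $\mu,\alpha>0$ such that - $a(w,v)\le \mu\|w\|_U\|v\|_V$ for all $w\in U$, $v\in V$; - $\sup_{0\ne v\in V} a(w,v)/\|v\|_V\ge \alpha\|w\|_U$ for all $w\in U$; - for $v\in V$: if $a(w,v)=0$ for all $w\in U$, then $v=0$. Under these assumptions the continuous problem has a unique solution $u$. Neural networks: the elements of $U$ are functions of $\mathbf{x}=(x_1,\dots,x_d)$. For a fixed fully-connected feedforward architecture with $L$ layers and nonlinear activation $\sigma$, the parameter vector $\theta\in\mathbb{R}^S$ collects all weights $\mathbf{w}^{(l)}$ and biases $\mathbf{b}^{(l)}$, and $u_\theta(\mathbf{x})=\mathbf{w}^{(L)}\mathbf{z}^{(L-1)}+\mathbf{b}^{(L)}$,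 where $\mathbf{z}^{(0)}=\mathbf{x}$ and $\mathbf{z}^{(l)}=\sigma(\mathbf{w}^{(l)}\mathbf{z}^{(l-1)}+\mathbf{b}^{(l)})$ for $l=1,\dots,L-1$. $U_{NN}:=\{u_\theta:\theta\in\mathbb{R}^S\}\cap U$, assumed nonempty. *)

theory Defs
  imports
    "HOL-Analysis.Linear_Algebra"
    "HOL-Library.Extended_Real"
    "HOL-Library.FuncSet"
    "Jordan_Normal_Form.Matrix"
begin

text \<open>
  An architecture with \<open>L\<close> layers is given by its widths \<open>n 0, \<dots>, n L\<close>, where \<open>n 0\<close> is the input
  and \<open>n L\<close> the output dimension. All weights and biases are stored in one vector \<open>\<theta>\<close>: the
  block of layer \<open>l\<close> starts at \<open>layer_offset n l\<close> and consists of the \<open>n l \<times> n (l - 1)\<close> weight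
  matrix, row by row, followed by the \<open>n l\<close> biases.
\<close>

definition layer_offset :: "(nat \<Rightarrow> nat) \<Rightarrow> nat \<Rightarrow> nat" where
  "layer_offset n l = (\<Sum>k = 1..<l. n k * n (k - 1) + n k)"

definition num_params :: "nat \<Rightarrow> (nat \<Rightarrow> nat) \<Rightarrow> nat" where
  "num_params L n = (\<Sum>k = 1..L. n k * n (k - 1) + n k)"

definition weights :: "(nat \<Rightarrow> nat) \<Rightarrow> real vec \<Rightarrow> nat \<Rightarrow> real mat" where
  "weights n \<theta> l =
     mat (n l) (n (l - 1)) (\<lambda>(i, j). \<theta> $ (layer_offset n l + i * n (l - 1) + j))"

definition biases :: "(nat \<Rightarrow> nat) \<Rightarrow> real vec \<Rightarrow> nat \<Rightarrow> real vec" where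
  "biases n \<theta> l = vec (n l) (\<lambda>i. \<theta> $ (layer_offset n l + n l * n (l - 1) + i))"

primrec hidden_layer ::
    "(nat \<Rightarrow> nat) \<Rightarrow> (real \<Rightarrow> real) \<Rightarrow> real vec \<Rightarrow> real vec \<Rightarrow> nat \<Rightarrow> real vec" where
  "hidden_layer n \<sigma> \<theta> x 0 = x"
| "hidden_layer n \<sigma> \<theta> x (Suc l) =
     map_vec \<sigma> (weights n \<theta> (Suc l) *\<^sub>v hidden_layer n \<sigma> \<theta> x l + biases n \<theta> (Suc l))"

definition nn_fun ::
    "nat \<Rightarrow> (nat \<Rightarrow> nat) \<Rightarrow> (real \<Rightarrow> real) \<Rightarrow> real vec \<Rightarrow> real vec \<Rightarrow> real vec" where
  "nn_fun L n \<sigma> \<theta> x = weights n \<theta> L *\<^sub>v hidden_layer n \<sigma> \<theta> x (L - 1) + biases n \<theta> L"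

text \<open>
  The elements of the abstract Hilbert space \<open>'u\<close> are functions from a domain \<open>\<Omega>\<close> in \<open>\<real>\<^sup>d\<close> to
  \<open>\<real>\<^sup>m\<close> (\<open>m = 1\<close> in the scalar case), possibly only up to an identification such as equality almost
  everywhere. Here \<open>R w\<close> is the set of pointwise functions that represent \<open>w\<close>. If \<open>'u\<close> is literally
  a space of functions on \<open>\<Omega>\<close>, then \<open>R w\<close> is the set of all functions that agree with \<open>w\<close> on \<open>\<Omega>\<close>.
\<close>

definition function_space ::
    "nat \<Rightarrow> nat \<Rightarrow> real vec set \<Rightarrow> ('u::real_vector \<Rightarrow> (real vec \<Rightarrow> real vec) set) \<Rightarrow> bool" where
  "function_space d m \<Omega> R \<longleftrightarrow>
     \<Omega> \<subseteq> carrier_vec d \<and>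
     (\<forall>w. R w \<noteq> {} \<and> R w \<subseteq> \<Omega> \<rightarrow> carrier_vec m) \<and>
     (\<forall>w f g. f \<in> R w \<and> (\<forall>x\<in>\<Omega>. g x = f x) \<longrightarrow> g \<in> R w) \<and>
     (\<forall>w w' f. f \<in> R w \<and> f \<in> R w' \<longrightarrow> w = w') \<and>
     (\<forall>w w' f g. f \<in> R w \<and> g \<in> R w' \<longrightarrow> (\<lambda>x. f x + g x) \<in> R (w + w')) \<and>
     (\<forall>c w f. f \<in> R w \<longrightarrow> (\<lambda>x. c \<cdot>\<^sub>v f x) \<in> R (c *\<^sub>R w))"

definition nn_space ::
    "nat \<Rightarrow> (nat \<Rightarrow> nat) \<Rightarrow> (real \<Rightarrow> real) \<Rightarrow> ('u \<Rightarrow> (real vec \<Rightarrow> real vec) set) \<Rightarrow> 'u set" where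
  "nn_space L n \<sigma> R = {w. \<exists>\<theta>\<in>carrier_vec (num_params L n). nn_fun L n \<sigma> \<theta> \<in> R w}"

end

theory Submission
  imports Defs
begin

theorem corollary3:
  fixes a :: "'u::{real_inner, complete_space} \<Rightarrow> 'v::{real_inner, complete_space} \<Rightarrow> real"
    and l :: "'v \<Rightarrow> real"
    and \<mu> \<alpha> :: real
    and L :: nat and n :: "nat \<Rightarrow> nat" and \<sigma> :: "real \<Rightarrow> real"
    and \<Omega> :: "real vec set" and R :: "'u \<Rightarrow> (real vec \<Rightarrow> real vec) set"
    and \<theta> :: "real vec" and u u\<^sub>\<theta> :: 'u and V\<^sub>M :: "'v set" and \<phi> :: 'v
  assumes l: "bounded_linear l"
    and a: "bilinear a"
    and "\<mu> > 0" and "\<alpha> > 0"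
    and continuity: "\<And>w v. a w v \<le> \<mu> * norm w * norm v"
    and inf_sup: "\<And>w. (SUP v\<in>{v. v \<noteq> 0}. ereal (a w v / norm v)) \<ge> ereal (\<alpha> * norm w)"
    and nondegenerate: "\<And>v. (\<forall>w. a w v = 0) \<Longrightarrow> v = 0"
    and architecture: "L \<ge> 1" "\<And>k. k \<le> L \<Longrightarrow> n k > 0"
    and activation: "\<not> linear \<sigma>"
    and elements: "function_space (n 0) (n L) \<Omega> R"
    and u: "\<And>v. a u v = l v"
    and \<theta>: "\<theta> \<in> carrier_vec (num_params L n)"
    and u\<^sub>\<theta>: "u\<^sub>\<theta> \<in> nn_space L n \<sigma> R" "nn_fun L n \<sigma> \<theta> \<in> R u\<^sub>\<theta>"
    and V\<^sub>M: "subspace V\<^sub>M" "\<exists>B. finite B \<and> V\<^sub>M = span B"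
    and \<phi>: "\<phi> \<in> V\<^sub>M" "\<And>v\<^sub>M. v\<^sub>M \<in> V\<^sub>M \<Longrightarrow> inner \<phi> v\<^sub>M = l v\<^sub>M - a u\<^sub>\<theta> v\<^sub>M"
  shows "1 / \<mu> * norm \<phi> \<le> norm (u - u\<^sub>\<theta>)"
proof -
  have "norm \<phi> * norm \<phi> = inner \<phi> \<phi>"
    by (simp add: norm_eq_sqrt_inner)
  \<comment> \<open>The discrete equation is tested with \<open>\<phi>\<close> itself, which is
    admissible because \<open>\<phi>\<close> lies in \<open>V\<^sub>M\<close>; rewriting
    \<open>l \<phi>\<close> as \<open>a u \<phi>\<close> then turns the residual into the
    error.\<close>
  also have "\<dots> = a (u - u\<^sub>\<theta>) \<phi>"
    using \<phi> by (simp add: u bilinear_lsub[OF a])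
  also have "\<dots> \<le> \<mu> * norm (u - u\<^sub>\<theta>) * norm \<phi>"
    by (rule continuity)
  \<comment> \<open>One factor \<open>norm \<phi>\<close> cancels when \<open>\<phi>\<close> is
    nonzero; for \<open>\<phi> = 0\<close> the bound only says that the right-hand side is
    nonnegative.\<close>
  finally have "norm \<phi> \<le> \<mu> * norm (u - u\<^sub>\<theta>)"
    using \<open>\<mu> > 0\<close> by (cases "\<phi> = 0") auto
  then show ?thesis
    using \<open>\<mu> > 0\<close> by (simp add: field_simps)
qed

end
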